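(* (i) If $n=1$ or $n=2$, then the lattice $P_n$ of partitions of an $n$-element set is isomorphic to the lattice induced by a covering, i.e. there are a finite set $U$ and a covering $\mathcal{C}$ of $U$ with $L(\mathcal{C})\cong P_n$. (ii) Let $\mathcal{C}$ be a covering of a finite set $U$ with $|U|=m$, such that there are no two distinct elements $u,v\in U$ with $\mathcal{C}(\{u\})=\mathcal{C}(\{v\})$ and $|\mathcal{C}(\{u\})|=1$. Suppose that $L(\mathcal{C})$ is uniform and $|L^{(2)}(\mathcal{C})|<\binom{m}{2}$, and let $k:=|\mathcal{E}|$. If $m=3$ and $k=1$, then $L(\mathcal{C})\cong P_3$.
   Context: A covering of a finite set $U$ (possibly empty) is a collection $\mathcal{C}\subseteq 2^U$ of subsets of $U$ whose union is $U$. For $H\subseteq U$, $\mathcal{C}(H):=\{C\in\mathcal{C} : C\cap H\neq\emptyset\}$. The matroid $M(\mathcal{C})$ is the transversal matroid of $\mathcal{C}$ on the ground set $U$: its independent sets are the partial transversals of $\mathcal{C}$, i.e. the sets $I\subseteq U$ for which there is an injective map $\varphi:I\to\mathcal{C}$ with $e\in\varphi(e)$ for all $e\in I$. $L(\mathcal{C})$ is the lattice of closed sets (flats) of $M(\mathcal{C})$ ordered by inclusion, and $L^{(\ell)}(\mathcal{C})$ is the set of its elements of height $\ell$. A ranked lattice is uniform if any two elements of equal rank are covered by the same number of elements. $P_n$ is ordered by refinement: $\pi\leq\sigma$ if every block of $\pi$ is contained in a block of $\sigma$. For $x\in U$ with $|\mathcal{C}(\{x\})|=2$, $E(\{x\}):=\{y\in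 U : \mathcal{C}(\{y\})\subseteq\mathcal{C}(\{x\})\}$, and $\mathcal{E}:=\{E(\{x\}) : x\in U,\ |\mathcal{C}(\{x\})|=2\}$. *)

theory Defs
  imports "HOL-Library.Disjoint_Sets"
begin

text \<open>\<^term>\<open>\<Union>\<C> = U\<close> already forces every member of \<open>\<C>\<close> to be a subset of \<open>U\<close>.
  The set \<open>U\<close> may be empty, and the empty set may belong to \<open>\<C>\<close>.\<close>
definition covering :: "'a set \<Rightarrow> 'a set set \<Rightarrow> bool" where
  "covering U \<C> \<longleftrightarrow> finite U \<and> \<Union>\<C> = U"

text \<open>Usually written \<open>\<C>(H)\<close>.\<close>
definition meeting :: "'a set set \<Rightarrow> 'a set \<Rightarrow> 'a set set" where
  "meeting \<C> H = {C \<in> \<C>. C \<inter> H \<noteq> {}}"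

definition partial_transversal :: "'a set \<Rightarrow> 'a set set \<Rightarrow> 'a set \<Rightarrow> bool" where
  "partial_transversal U \<C> I \<longleftrightarrow>
     I \<subseteq> U \<and> (\<exists>\<phi>. inj_on \<phi> I \<and> (\<forall>e\<in>I. \<phi> e \<in> \<C> \<and> e \<in> \<phi> e))"

definition matroid_rank :: "'a set \<Rightarrow> 'a set set \<Rightarrow> 'a set \<Rightarrow> nat" where
  "matroid_rank U \<C> X = Max (card ` {I. I \<subseteq> X \<and> partial_transversal U \<C> I})"

definition matroid_closure :: "'a set \<Rightarrow> 'a set set \<Rightarrow> 'a set \<Rightarrow> 'a set" where
  "matroid_closure U \<C> X = {e \<in> U. matroid_rank U \<C> (insert e X) = matroid_rank U \<C> X}"

text \<open>The carrier of \<open>L(\<C>)\<close>; the order is always \<open>(\<subseteq>)\<close>.\<close>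
definition flats :: "'a set \<Rightarrow> 'a set set \<Rightarrow> 'a set set" where
  "flats U \<C> = {F. F \<subseteq> U \<and> matroid_closure U \<C> F = F}"

text \<open>The height of \<open>x\<close> is the greatest length \<open>l\<close> of a chain
  \<open>x\<^sub>0 \<subset> \<dots> \<subset> x\<^sub>l = x\<close>, that is, the greatest size of a chain of elements strictly below \<open>x\<close>.
  In a ranked lattice, such as \<open>L(\<C>)\<close>, this is the rank of \<open>x\<close>.\<close>
definition height :: "'a set set \<Rightarrow> 'a set \<Rightarrow> nat" where
  "height L x = Max (card ` {K. subset.chain {y \<in> L. y \<subset> x} K})"

definition level :: "'a set set \<Rightarrow> nat \<Rightarrow> 'a set set" where
  "level L l = {x \<in> L. height L x = l}"

definition covered_by :: "'a set set \<Rightarrow> 'a set \<Rightarrow> 'a set \<Rightarrow> bool" where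
  "covered_by L x y \<longleftrightarrow> x \<in> L \<and> y \<in> L \<and> x \<subset> y \<and> \<not> (\<exists>z\<in>L. x \<subset> z \<and> z \<subset> y)"

definition uniform_lattice :: "'a set set \<Rightarrow> bool" where
  "uniform_lattice L \<longleftrightarrow>
     (\<forall>x\<in>L. \<forall>y\<in>L. height L x = height L y \<longrightarrow>
        card {z. covered_by L x z} = card {z. covered_by L y z})"

definition partitions :: "nat \<Rightarrow> nat set set set" where
  "partitions n = {\<pi>. partition_on {1..n} \<pi>}"

text \<open>An order isomorphism between lattices is the same thing as a lattice isomorphism.
  The order of \<^term>\<open>partitions n\<close> is the refinement order \<^term>\<open>refines {1..n}\<close>.\<close>
definition order_isomorphic ::
    "'a set \<Rightarrow> ('a \<Rightarrow> 'a \<Rightarrow> bool) \<Rightarrow> 'b set \<Rightarrow> ('b \<Rightarrow> 'b \<Rightarrow> bool) \<Rightarrow> bool" where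
  "order_isomorphic A le B le' \<longleftrightarrow>
     (\<exists>f. bij_betw f A B \<and> (\<forall>x\<in>A. \<forall>y\<in>A. le x y \<longleftrightarrow> le' (f x) (f y)))"

definition induces_partition_lattice :: "'a set \<Rightarrow> 'a set set \<Rightarrow> nat \<Rightarrow> bool" where
  "induces_partition_lattice U \<C> n \<longleftrightarrow>
     order_isomorphic (flats U \<C>) (\<subseteq>) (partitions n) (refines {1..n})"

definition E_set :: "'a set \<Rightarrow> 'a set set \<Rightarrow> 'a \<Rightarrow> 'a set" where
  "E_set U \<C> x = {y \<in> U. meeting \<C> {y} \<subseteq> meeting \<C> {x}}"

definition E_family :: "'a set \<Rightarrow> 'a set set \<Rightarrow> 'a set set" where
  "E_family U \<C> = {E_set U \<C> x | x. x \<in> U \<and> card (meeting \<C> {x}) = 2}"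

end

theory Submission
  imports Defs
begin

text \<open>
  Since \<open>\<C>\<close> covers \<open>U\<close> and no two elements lie in one and the same single block, \<open>M(\<C>)\<close> has
  neither loops nor parallel elements, so on a three-element ground set it is either the free
  matroid or the uniform matroid of rank two. The free matroid has \<open>m choose 2\<close> flats of height two,
  which excludes it; the five flats of the other one form the lattice \<open>P\<^sub>3\<close>.
\<close>

section \<open>Independent sets and the rank function\<close>

lemma partial_transversal_subset:
  "partial_transversal U \<C> J \<Longrightarrow> I \<subseteq> J \<Longrightarrow> partial_transversal U \<C> I"
  unfolding partial_transversal_def by (meson inj_on_subset subset_eq)

lemma partial_transversal_empty: "partial_transversal U \<C> {}"
  by (simp add: partial_transversal_def)

text \<open>The sets over which \<open>Max\<close> is taken form a finite family containing
  \<open>{}\<close>, so the maximum is a genuine one, reached by some independent subset.\<close>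

lemma matroid_rank_attained:
  assumes "finite X"
  obtains I where "I \<subseteq> X" "partial_transversal U \<C> I" "matroid_rank U \<C> X = card I"
proof -
  have "finite {I. I \<subseteq> X \<and> partial_transversal U \<C> I}"
    using assms by simp
  moreover have "{} \<in> {I. I \<subseteq> X \<and> partial_transversal U \<C> I}"
    by (simp add: partial_transversal_empty)
  ultimately have "matroid_rank U \<C> X \<in> card ` {I. I \<subseteq> X \<and> partial_transversal U \<C> I}"
    unfolding matroid_rank_def by (intro Max_in) auto
  then show thesis
    using that by blast
qed

lemma card_le_matroid_rank:
  assumes "finite X" "I \<subseteq> X" "partial_transversal U \<C> I"
  shows "card I \<le> matroid_rank U \<C> X"
  unfolding matroid_rank_def using assms by (intro Max_ge) auto

lemma matroid_rank_independent:
  assumes "finite X" "partial_transversal U \<C> X"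
  shows "matroid_rank U \<C> X = card X"
  using assms by (metis card_le_matroid_rank card_mono matroid_rank_attained le_antisym order_refl)

text \<open>The hypotheses say that \<open>X\<close> is a circuit: an independent subset must miss
  an element, and removing just one element leaves an independent set. The truncated subtraction is
  harmless, since \<open>{}\<close> is independent and hence \<open>X\<close> is nonempty.\<close>

lemma matroid_rank_circuit:
  assumes "finite X" "\<not> partial_transversal U \<C> X" "\<And>I. I \<subset> X \<Longrightarrow> partial_transversal U \<C> I"
  shows "matroid_rank U \<C> X = card X - 1"
proof (rule antisym)
  obtain I where I: "I \<subseteq> X" "partial_transversal U \<C> I" "matroid_rank U \<C> X = card I"
    using matroid_rank_attained assms(1) .
  then have "card I < card X"
    using assms by (metis psubsetI psubset_card_mono)
  with I show "matroid_rank U \<C> X \<le> card X - 1"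
    by simp
next
  have "X \<noteq> {}"
    using assms(2) partial_transversal_empty by metis
  then obtain x where x: "x \<in> X" by blast
  then have "partial_transversal U \<C> (X - {x})"
    by (intro assms(3)) blast
  then have "card (X - {x}) \<le> matroid_rank U \<C> X"
    by (intro card_le_matroid_rank assms(1)) auto
  then show "card X - 1 \<le> matroid_rank U \<C> X"
    using x assms(1) by simp
qed

section \<open>Flats of the free matroid and of a circuit\<close>

lemma in_flats_iff:
  assumes "F \<subseteq> U"
  shows "F \<in> flats U \<C> \<longleftrightarrow>
    (\<forall>e\<in>U - F. matroid_rank U \<C> (insert e F) \<noteq> matroid_rank U \<C> F)"
proof -
  \<comment> \<open>Inserting a member of \<open>F\<close> changes nothing, so the closure always
    contains \<open>F\<close>; only elements outside \<open>F\<close> can prevent \<open>F\<close>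
    from being closed.\<close>
  have "e \<in> matroid_closure U \<C> F" if "e \<in> F" for e
    using that assms by (auto simp: matroid_closure_def insert_absorb)
  then show ?thesis
    using assms by (auto simp: flats_def matroid_closure_def)
qed

text \<open>Rank equals cardinality on all subsets of \<open>U\<close>, so every new element raises
  the rank.\<close>

lemma flats_free:
  assumes "finite U" "partial_transversal U \<C> U"
  shows "flats U \<C> = Pow U"
proof -
  have "F \<in> flats U \<C>" if "F \<subseteq> U" for F
  proof -
    have "matroid_rank U \<C> X = card X" if "X \<subseteq> U" for X
      using that assms
      by (meson finite_subset matroid_rank_independent partial_transversal_subset)
    moreover have "finite F"
      using that assms(1) finite_subset by blast
    ultimately show ?thesis
      using that by (simp add: in_flats_iff)
  qed
  then show ?thesis
    by (auto simp: flats_def)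
qed

text \<open>Here the whole ground set is a circuit. A set with one element missing already has full
  rank, so its closure is \<open>U\<close>; smaller sets stay independent when an element is added,
  and \<open>U\<close> is closed trivially.\<close>

lemma flats_circuit:
  assumes "finite U" "\<not> partial_transversal U \<C> U" "\<And>I. I \<subset> U \<Longrightarrow> partial_transversal U \<C> I"
  shows "flats U \<C> = {F. F \<subseteq> U \<and> Suc (card F) \<noteq> card U}"
proof -
  have "F \<in> flats U \<C> \<longleftrightarrow> Suc (card F) \<noteq> card U" if "F \<subseteq> U" for F
  proof (cases "F = U")
    case True
    then show ?thesis by (simp add: in_flats_iff)
  next
    case False
    have fin: "finite F"
      using that assms(1) finite_subset by blast
    have rank_F: "matroid_rank U \<C> F = card F"
      using False that fin assms(3) by (simp add: matroid_rank_independent psubsetI)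
    have rank_insert: "matroid_rank U \<C> (insert e F) = card F \<longleftrightarrow> Suc (card F) = card U"
      if e: "e \<in> U - F" for e
    proof (cases "insert e F = U")
      case True
      then have "card U = Suc (card F)"
        using e fin by auto
      then show ?thesis
        using True matroid_rank_circuit[OF assms] by simp
    next
      case False
      then have sub: "insert e F \<subset> U"
        using e \<open>F \<subseteq> U\<close> by blast
      then have "Suc (card F) < card U"
        using psubset_card_mono[OF assms(1) sub] e fin by simp
      moreover have "matroid_rank U \<C> (insert e F) = Suc (card F)"
        using sub e fin assms(3) by (simp add: matroid_rank_independent)
      ultimately show ?thesis by simp
    qed
    \<comment> \<open>The right-hand side of \<open>rank_insert\<close> does not mention
      \<open>e\<close>, so any one element outside \<open>F\<close> decides whether \<open>F\<close>
      is closed; such an element exists because \<open>F\<close> is a proper subset.\<close>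
    obtain e where "e \<in> U - F"
      using False \<open>F \<subseteq> U\<close> by blast
    then show ?thesis
      using that rank_F rank_insert by (auto simp: in_flats_iff)
  qed
  then show ?thesis
    by (auto simp: flats_def)
qed

section \<open>Heights in the Boolean lattice\<close>

lemma height_Pow:
  assumes "finite U" "X \<subseteq> U"
  shows "height (Pow U) X = card X"
proof -
  have fin: "finite X"
    using assms finite_subset by blast
  let ?A = "{y \<in> Pow U. y \<subset> X}"
  \<comment> \<open>Comparable finite sets of equal size coincide, so \<open>card\<close> is
    injective on a chain; on proper subsets of \<open>X\<close> it takes only values below
    \<open>card X\<close>.\<close>
  have upper: "card K \<le> card X" if "subset.chain ?A K" for K
  proof -
    have K: "K \<subseteq> ?A" "\<And>x y. x \<in> K \<Longrightarrow> y \<in> K \<Longrightarrow> x \<subseteq> y \<or> y \<subseteq> x"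
      using that by (auto simp: subset_chain_def)
    have "inj_on card K"
    proof (rule inj_onI)
      fix x y assume xy: "x \<in> K" "y \<in> K" "card x = card y"
      then have "x \<subset> X" "y \<subset> X"
        using K(1) by blast+
      then have "finite x" "finite y"
        using fin by (auto intro: finite_subset)
      then show "x = y"
        using K(2)[OF xy(1,2)] xy(3) card_subset_eq[of x y] card_subset_eq[of y x] by auto
    qed
    moreover have "card ` K \<subseteq> {..<card X}"
      using K(1) fin by (auto intro!: psubset_card_mono)
    ultimately show ?thesis
      by (metis card_inj_on_le card_lessThan finite_lessThan)
  qed
  \<comment> \<open>For the lower bound, enumerate \<open>X\<close>: the initial segments of the
    enumeration of lengths \<open>0\<close> to \<open>card X - 1\<close> form a chain of
    \<open>card X\<close> proper subsets.\<close>
  obtain f where f: "bij_betw f {..<card X} X"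
    using fin ex_bij_betw_nat_finite atLeast0LessThan by metis
  define K where "K = (\<lambda>i. f ` {..<i}) ` {..<card X}"
  have initial: "f ` {..<i} \<subseteq> X" "card (f ` {..<i}) = i" if "i \<le> card X" for i
  proof -
    have "inj_on f {..<i}" "f ` {..<i} \<subseteq> f ` {..<card X}"
      using that f by (auto simp: bij_betw_def intro: inj_on_subset)
    then show "f ` {..<i} \<subseteq> X" "card (f ` {..<i}) = i"
      using f by (simp_all add: bij_betw_def card_image)
  qed
  have "subset.chain ?A K"
    unfolding subset_chain_def
  proof (intro conjI ballI)
    have "f ` {..<i} \<in> ?A" if "i < card X" for i
    proof -
      have "f ` {..<i} \<subseteq> X" "card (f ` {..<i}) \<noteq> card X"
        using initial[of i] that by simp_all
      then show ?thesis
        using assms(2) by blast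
    qed
    then show "K \<subseteq> ?A"
      unfolding K_def by blast
    show "x \<subseteq> y \<or> y \<subseteq> x" if xy: "x \<in> K" "y \<in> K" for x y
    proof -
      obtain i j where ij: "x = f ` {..<i}" "y = f ` {..<j}"
        using xy unfolding K_def by blast
      have "i \<le> j \<or> j \<le> i" by linarith
      then show ?thesis
        unfolding ij by (meson image_mono lessThan_subset_iff)
    qed
  qed
  \<comment> \<open>A segment determines its length: \<open>card\<close> is a left inverse.\<close>
  moreover have "inj_on (\<lambda>i. f ` {..<i}) {..<card X}"
    by (rule inj_on_inverseI[of _ card]) (simp add: initial(2))
  then have "card K = card X"
    by (simp add: K_def card_image)
  ultimately have "card X \<in> card ` {K. subset.chain ?A K}"
    by (intro image_eqI[of _ _ K]) simp_all
  \<comment> \<open>The upper bound also makes the set of chain sizes finite, as \<open>Max\<close>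
    requires.\<close>
  moreover have "card ` {K. subset.chain ?A K} \<subseteq> {..card X}"
    using upper by blast
  then have "finite (card ` {K. subset.chain ?A K})"
    using finite_atMost finite_subset by metis
  ultimately show ?thesis
    unfolding height_def using upper by (intro Max_eqI) blast+
qed

lemma card_level_Pow:
  assumes "finite U"
  shows "card (level (Pow U) l) = card U choose l"
proof -
  have "level (Pow U) l = {X. X \<subseteq> U \<and> card X = l}"
    using assms by (auto simp: level_def height_Pow)
  then show ?thesis
    using assms by (simp add: n_subsets)
qed

section \<open>Independence of pairs\<close>

lemma partial_transversal_pair:
  assumes "\<Union>\<C> = U" "u \<in> U" "v \<in> U"
    and simple: "\<not> (meeting \<C> {u} = meeting \<C> {v} \<and> card (meeting \<C> {u}) = 1)"
  shows "partial_transversal U \<C> {u, v}"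
proof (cases "u = v")
  case True
  obtain C where "C \<in> \<C>" "u \<in> C"
    using assms by blast
  then show ?thesis
    using True assms by (auto simp: partial_transversal_def intro!: exI[of _ "\<lambda>_. C"])
next
  case False
  obtain C D where CD: "C \<in> \<C>" "u \<in> C" "D \<in> \<C>" "v \<in> D" "C \<noteq> D"
  proof (rule ccontr)
    assume contra: "\<not> thesis"
    obtain C D where *: "C \<in> \<C>" "u \<in> C" "D \<in> \<C>" "v \<in> D"
      using assms(1-3) by blast
    \<comment> \<open>Without two distinct representatives, every block through \<open>u\<close>
      equals every block through \<open>v\<close>. Both families then reduce to the same singleton,
      which \<open>simple\<close> forbids.\<close>
    have "meeting \<C> {u} = {C}" "meeting \<C> {v} = {C}"
      using * contra that by (auto simp: meeting_def)
    then show False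
      using simple by simp
  qed
  then show ?thesis
    using False assms
    by (auto simp: partial_transversal_def intro!: exI[of _ "\<lambda>e. if e = u then C else D"])
qed

section \<open>Partitions of sets with at most three elements\<close>

lemma partition_on_split_block:
  assumes "partition_on A P" "a \<in> A"
  obtains p Q where "P = insert p Q" "a \<in> p" "p \<subseteq> A" "partition_on (A - p) Q"
proof -
  obtain p where p: "p \<in> P" "a \<in> p"
    using assms by (auto simp: partition_on_def)
  \<comment> \<open>Disjointness of the blocks makes the remaining ones a partition of the
    complement of \<open>p\<close>, which allows enumeration by recursion on smaller sets.\<close>
  have "partition_on (A - p) (P - {p})"
    using assms(1) p(1) by (auto simp: partition_on_def disjoint_def)
  moreover have "P = insert p (P - {p})" "p \<subseteq> A"
    using p(1) assms(1) by (auto simp: partition_on_def)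
  ultimately show thesis
    using that p(2) by blast
qed

lemma partition_on_singleton_iff: "partition_on {a} P \<longleftrightarrow> P = {{a}}"
proof
  assume P: "partition_on {a} P"
  have "x = {a}" if "x \<in> P" for x
  proof -
    have "x \<subseteq> {a}" "x \<noteq> {}"
      using that P by (auto simp: partition_on_def)
    then show ?thesis by blast
  qed
  moreover have "P \<noteq> {}"
    using P by (auto simp: partition_on_def)
  ultimately show "P = {{a}}" by blast
qed (auto simp: partition_on_def)

lemma partition_on_doubleton_iff:
  assumes "a \<noteq> b"
  shows "partition_on {a, b} P \<longleftrightarrow> P = {{a}, {b}} \<or> P = {{a, b}}"
proof
  assume "partition_on {a, b} P"
  then obtain p Q where P: "P = insert p Q" "a \<in> p" "p \<subseteq> {a, b}"
    and Q: "partition_on ({a, b} - p) Q"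
    by (rule partition_on_split_block[OF _ insertI1])
  have "p = {a} \<or> p = {a, b}"
    using P by blast
  then show "P = {{a}, {b}} \<or> P = {{a, b}}"
    using P(1) Q assms by (elim disjE) (simp_all add: partition_on_empty partition_on_singleton_iff insert_Diff_if)
next
  assume "P = {{a}, {b}} \<or> P = {{a, b}}"
  then show "partition_on {a, b} P"
    using assms by (auto simp: partition_on_def disjoint_def)
qed

lemma partition_on_tripleton_iff:
  assumes "a \<noteq> b" "a \<noteq> c" "b \<noteq> c"
  shows "partition_on {a, b, c} P \<longleftrightarrow>
    P \<in> {{{a}, {b}, {c}}, {{a}, {b, c}}, {{b}, {a, c}}, {{c}, {a, b}}, {{a, b, c}}}"
proof
  assume "partition_on {a, b, c} P"
  then obtain p Q where P: "P = insert p Q" "a \<in> p" "p \<subseteq> {a, b, c}"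
    and Q: "partition_on ({a, b, c} - p) Q"
    by (rule partition_on_split_block[OF _ insertI1])
  \<comment> \<open>The block of \<open>a\<close> has four possible values. Its complement has two,
    one, one or no elements, so the smaller enumerations list the possible \<open>Q\<close>.\<close>
  have "p = {a} \<or> p = {a, b} \<or> p = {a, c} \<or> p = {a, b, c}"
    using P by blast
  then have "p = {a} \<and> (Q = {{b}, {c}} \<or> Q = {{b, c}}) \<or>
    p = {a, b} \<and> Q = {{c}} \<or> p = {a, c} \<and> Q = {{b}} \<or> p = {a, b, c} \<and> Q = {}"
    using Q assms
    by (elim disjE)
      (simp_all add: partition_on_empty partition_on_singleton_iff partition_on_doubleton_iff
        insert_Diff_if)
  then show
    "P \<in> {{{a}, {b}, {c}}, {{a}, {b, c}}, {{b}, {a, c}}, {{c}, {a, b}}, {{a, b, c}}}"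
    by (elim disjE conjE) (simp_all add: P(1) insert_commute)
next
  assume "P \<in> {{{a}, {b}, {c}}, {{a}, {b, c}}, {{b}, {a, c}}, {{c}, {a, b}}, {{a, b, c}}}"
  then show "partition_on {a, b, c} P"
    using assms by (elim insertE) (simp_all add: partition_on_def disjoint_def insert_commute)
qed

lemma partitions_1: "partitions 1 = {{{1}}}"
  by (auto simp: partitions_def partition_on_singleton_iff)

lemma partitions_2: "partitions 2 = {{{1}, {2}}, {{1, 2}}}"
proof -
  have "{1..2::nat} = {1, 2}" by auto
  then show ?thesis
    by (auto simp: partitions_def partition_on_doubleton_iff)
qed

lemma partitions_3:
  "partitions 3 = {{{1}, {2}, {3}}, {{1}, {2, 3}}, {{2}, {1, 3}}, {{3}, {1, 2}}, {{1, 2, 3}}}"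
proof -
  have "{1..3::nat} = {1, 2, 3}" by auto
  moreover have "partition_on {1, 2, 3} P \<longleftrightarrow>
    P \<in> {{{1}, {2}, {3}}, {{1}, {2, 3}}, {{2}, {1, 3}}, {{3}, {1, 2}}, {{1, 2, 3}}}"
    for P :: "nat set set"
    by (rule partition_on_tripleton_iff) simp_all
  ultimately show ?thesis
    unfolding partitions_def by (intro set_eqI) (simp only: mem_Collect_eq)
qed

section \<open>Refinement and explicit isomorphisms\<close>

lemma refines_partitions_iff:
  assumes "P \<in> partitions n" "Q \<in> partitions n"
  shows "refines {1..n} P Q \<longleftrightarrow> (\<forall>X\<in>P. \<exists>Y\<in>Q. X \<subseteq> Y)"
  \<comment> \<open>\<open>refines\<close> also requires both sides to be partitions; once that is
    supplied, only inclusion of blocks is left to check.\<close>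
  using assms by (simp add: partitions_def refines_def)

lemma induces_partition_lattice_1: "induces_partition_lattice {} {} 1"
proof -
  have "flats {} {} = {{} :: 'a set}"
    by (auto simp: flats_def matroid_closure_def)
  moreover have "refines {1..1} {{1::nat}} {{1}}"
    by (simp add: refines_def partition_on_singleton_iff)
  ultimately show ?thesis
    unfolding induces_partition_lattice_def order_isomorphic_def partitions_1
    by (intro exI[of _ "\<lambda>_. {{1}}"]) (auto simp: bij_betw_def)
qed

text \<open>A single independent element yields two flats, one below the other, and
  \<open>P_2\<close> is a two-element chain as well.\<close>

lemma induces_partition_lattice_2: "induces_partition_lattice {a} {{a}} 2"
proof -
  have "partial_transversal {a} {{a}} {a}"
    by (auto simp: partial_transversal_def)
  then have flats: "flats {a} {{a}} = {{}, {a}}"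
    by (simp add: flats_free Pow_insert insert_commute)
  define f where "f X = (if X = {} then {{1}, {2}} else {{1, 2::nat}})" for X :: "'a set"
  have "bij_betw f {{}, {a}} (partitions 2)"
    by (auto simp: bij_betw_def partitions_2 f_def doubleton_eq_iff)
  moreover have "X \<subseteq> Y \<longleftrightarrow> refines {1..2} (f X) (f Y)" if "X \<in> {{}, {a}}" "Y \<in> {{}, {a}}" for X Y
    using that by (subst refines_partitions_iff) (auto simp: partitions_2 f_def)
  ultimately show ?thesis
    unfolding induces_partition_lattice_def order_isomorphic_def flats by blast
qed

text \<open>Both sides are a bottom, a top and three pairwise incomparable elements between
  them.\<close>

lemma order_isomorphic_partitions_3:
  assumes "a \<noteq> b" "a \<noteq> c" "b \<noteq> c"
  shows "order_isomorphic {{}, {a}, {b}, {c}, {a, b, c}} (\<subseteq>) (partitions 3) (refines {1..3})"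
proof -
  let ?L = "{{}, {a}, {b}, {c}, {a, b, c}}"
  \<comment> \<open>Each atom goes to a partition that isolates one of the points \<open>1\<close>,
    \<open>2\<close>, \<open>3\<close>; the bottom goes to the discrete partition and the top to the
    single block.\<close>
  define f where "f X = (if X = {} then {{1}, {2}, {3}} else if X = {a} then {{1}, {2, 3}}
    else if X = {b} then {{2}, {1, 3}} else if X = {c} then {{3}, {1, 2}} else {{1, 2, 3::nat}})"
    for X
  have f: "f {} = {{1}, {2}, {3}}" "f {a} = {{1}, {2, 3}}" "f {b} = {{2}, {1, 3}}"
    "f {c} = {{3}, {1, 2}}" "f {a, b, c} = {{1, 2, 3}}"
    using assms by (simp_all add: f_def)
  have le_iff: "X \<subseteq> Y \<longleftrightarrow> refines {1..3} (f X) (f Y)" if "X \<in> ?L" "Y \<in> ?L" for X Y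
  proof -
    have "f X \<in> partitions 3" "f Y \<in> partitions 3"
      using that by (elim insertE; simp add: f partitions_3)+
    moreover have "X \<subseteq> Y \<longleftrightarrow> (\<forall>A\<in>f X. \<exists>B\<in>f Y. A \<subseteq> B)"
      using that assms by (elim insertE) (simp_all add: f)
    ultimately show ?thesis
      by (simp only: refines_partitions_iff)
  qed
  \<comment> \<open>An order embedding is injective: equal images refine each other, so their
    preimages include each other.\<close>
  have "inj_on f ?L"
  proof (rule inj_onI)
    fix X Y assume XY: "X \<in> ?L" "Y \<in> ?L" "f X = f Y"
    have "refines {1..3} (f X) (f X)"
      using le_iff[OF XY(1,1)] by (rule iffD1) (rule order_refl)
    then have "refines {1..3} (f X) (f Y)" "refines {1..3} (f Y) (f X)"
      by (simp_all only: XY(3))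
    then have "X \<subseteq> Y" "Y \<subseteq> X"
      by (simp_all only: le_iff[OF XY(1,2)] le_iff[OF XY(2,1)])
    then show "X = Y" by (rule subset_antisym)
  qed
  moreover have "f ` ?L = partitions 3"
    by (simp add: f partitions_3)
  ultimately have "bij_betw f ?L (partitions 3)"
    by (rule bij_betw_imageI)
  then show ?thesis
    unfolding order_isomorphic_def by (intro exI[of _ f] conjI ballI le_iff)
qed

section \<open>Coverings of a three-element set\<close>

lemma induces_partition_lattice_3:
  assumes cover: "covering U \<C>" and card: "card U = 3"
    and simple: "\<And>u v. u \<in> U \<Longrightarrow> v \<in> U \<Longrightarrow> u \<noteq> v \<Longrightarrow>
      \<not> (meeting \<C> {u} = meeting \<C> {v} \<and> card (meeting \<C> {u}) = 1)"
    and level: "card (level (flats U \<C>) 2) < 3 choose 2"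
  shows "induces_partition_lattice U \<C> 3"
proof -
  have fin: "finite U" and union: "\<Union>\<C> = U"
    using cover by (auto simp: covering_def)
  obtain a b c where U: "U = {a, b, c}" and dist: "a \<noteq> b" "a \<noteq> c" "b \<noteq> c"
    using card by (auto simp: card_3_iff)
  \<comment> \<open>Otherwise all subsets would be flats, and the number of flats of height two
    would equal \<open>3 choose 2\<close>, against \<open>level\<close>.\<close>
  have "\<not> partial_transversal U \<C> U"
    using level card fin by (auto simp: flats_free card_level_Pow)
  moreover have "partial_transversal U \<C> I" if "I \<subset> U" for I
  proof -
    \<comment> \<open>A proper subset of a triple lies in a pair, and pairs are independent by
      \<open>simple\<close>. Hence \<open>U\<close> is a circuit.\<close>
    have "I \<subseteq> {a, b} \<or> I \<subseteq> {a, c} \<or> I \<subseteq> {b, c}"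
      using that U by blast
    moreover have "partial_transversal U \<C> {u, v}" if "u \<in> U" "v \<in> U" "u \<noteq> v" for u v
      using that simple union by (intro partial_transversal_pair) auto
    ultimately show ?thesis
      using U dist by (meson insertCI partial_transversal_subset)
  qed
  ultimately have "flats U \<C> = {F. F \<subseteq> U \<and> card F \<noteq> 2}"
    using fin card flats_circuit[of U \<C>] by simp
  also have "\<dots> = {F \<in> Pow {a, b, c}. card F \<noteq> 2}"
    using U by blast
  also have "\<dots> = {{}, {a}, {b}, {c}, {a, b, c}}"
    using dist by (auto simp: Pow_insert)
  finally show ?thesis
    unfolding induces_partition_lattice_def
    using order_isomorphic_partitions_3 dist by metis
qed

theorem theorem4p12:
  shows "(\<forall>n::nat. n = 1 \<or> n = 2 \<longrightarrow>
            (\<exists>(U :: nat set) \<C>. covering U \<C> \<and> induces_partition_lattice U \<C> n)) \<and>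
         (\<forall>(U :: 'a set) \<C> m k.
            covering U \<C> \<longrightarrow> card U = m \<longrightarrow>
            \<not> (\<exists>u\<in>U. \<exists>v\<in>U. u \<noteq> v \<and> meeting \<C> {u} = meeting \<C> {v} \<and> card (meeting \<C> {u}) = 1) \<longrightarrow>
            uniform_lattice (flats U \<C>) \<longrightarrow>
            card (level (flats U \<C>) 2) < m choose 2 \<longrightarrow>
            k = card (E_family U \<C>) \<longrightarrow>
            m = 3 \<longrightarrow> k = 1 \<longrightarrow>
            induces_partition_lattice U \<C> 3)"
proof (intro conjI allI impI)
  fix n :: nat assume "n = 1 \<or> n = 2"
  \<comment> \<open>Witnesses: the empty covering of the empty set for \<open>n = 1\<close>, and one
    point covered by one block for \<open>n = 2\<close>.\<close>
  moreover have "covering ({} :: nat set) {} \<and> induces_partition_lattice ({} :: nat set) {} 1"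
    using induces_partition_lattice_1 by (simp add: covering_def)
  moreover have "covering {0 :: nat} {{0}} \<and> induces_partition_lattice {0 :: nat} {{0}} 2"
    using induces_partition_lattice_2 by (simp add: covering_def)
  ultimately show "\<exists>(U :: nat set) \<C>. covering U \<C> \<and> induces_partition_lattice U \<C> n"
    by metis
next
  fix U :: "'a set" and \<C> m k
  assume cover: "covering U \<C>" and card: "card U = m" "m = 3"
    and simple: "\<not> (\<exists>u\<in>U. \<exists>v\<in>U. u \<noteq> v \<and> meeting \<C> {u} = meeting \<C> {v} \<and> card (meeting \<C> {u}) = 1)"
    and level: "card (level (flats U \<C>) 2) < m choose 2"
  have "\<not> (meeting \<C> {u} = meeting \<C> {v} \<and> card (meeting \<C> {u}) = 1)"
    if "u \<in> U" "v \<in> U" "u \<noteq> v" for u v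
    using simple that by metis
  moreover have "card U = 3" "card (level (flats U \<C>) 2) < 3 choose 2"
    using card level by (simp_all only:)
  ultimately show "induces_partition_lattice U \<C> 3"
    using cover by (intro induces_partition_lattice_3)
qed

end
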